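(* Let $p,q,r\in\mathbb{R}$ with $r\notin-\mathbb{N}$. Then $_2F_1(p,q;r;x)>0$ for all $x\in(0,1)$ if and only if at least one of the following holds: \begin{enumerate} \item $r\geq1$, $r-p-q\leq0$ and $p,q\geq0$; \item $r\geq1$, $r-p-q\geq0$ and $r-p,\,r-q\geq0$; \item $r<1$, $r-p-q\leq0$, $r-p,\,r-q\leq1$ and $(p,q,r)\in S$; \item $r<1$, $r-p-q\geq0$, $p,q\leq1$ and $(r-p,r-q,r)\in S$. \end{enumerate}
   Context: $\mathbb{N}=\{0,1,2,\ldots\}$. $_2F_1(p,q;r;x)=\sum_{n\ge0}\frac{(p)_n(q)_n}{n!(r)_n}x^n$ with $(t)_0=1$, $(t)_{n+1}=(t+n)(t)_n$, for $0<x<1$. For $x\in\mathbb{R}$, $s(x)\in\{-1,0,1\}$ is the sign of $1/\Gamma(x)$ (with $1/\Gamma(-n)=0$ for $n\in\mathbb{N}$ and $\mathrm{sign}(0)=0$): $s(x)=1$ if $x>0$ or $-2k-2<x<-2k-1$ for some $k\in\mathbb{N}$; $s(x)=-1$ if $-2k-1<x<-2k$ for some $k\in\mathbb{N}$; $s(x)=0$ if $x\in-\mathbb{N}$. The set $S$ is $$S=\{(x,y,z)\in\mathbb{R}^3:\ s(x)s(y)s(z)\geq0\}.$$ *)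

theory Defs
  imports "HOL-Analysis.Analysis"
begin

text \<open>The power series of Gauss's function; it converges for \<open>\<bar>x\<bar> < 1\<close> when \<open>r\<close> is not a
  non-positive integer. Outside that range the value carries no meaning.\<close>

definition hyp2F1 :: "real \<Rightarrow> real \<Rightarrow> real \<Rightarrow> real \<Rightarrow> real" where
  "hyp2F1 p q r x =
     (\<Sum>n. pochhammer p n * pochhammer q n / (fact n * pochhammer r n) * x ^ n)"

text \<open>The library's \<^const>\<open>rGamma\<close> is the entire function 1/Gamma, which
  vanishes exactly at the non-positive integers.\<close>

definition gsign :: "real \<Rightarrow> real" where
  "gsign x = sgn (rGamma x)"

definition signset :: "(real \<times> real \<times> real) set" where
  "signset = {(x, y, z). gsign x * gsign y * gsign z \<ge> 0}"

lemma gsign_pos: "gsign x = 1" if "x > 0"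
  using that Gamma_real_pos[of x] by (simp add: gsign_def rGamma_inverse_Gamma)

lemma gsign_nonpos_Ints: "gsign x = 0" if "x \<in> \<int>\<^sub>\<le>\<^sub>0"
  using that by (auto simp: gsign_def rGamma_eq_zero_iff elim!: nonpos_Ints_cases')

lemma gsign_rec: "gsign x = sgn x * gsign (x + 1)"
  by (metis gsign_def rGamma_plus1 sgn_mult)

lemma gsign_between:
  "- real m - 1 < x \<Longrightarrow> x < - real m \<Longrightarrow> gsign x = (-1) ^ Suc m"
proof (induction m arbitrary: x)
  case 0
  then show ?case
    using gsign_rec[of x] gsign_pos[of "x + 1"] by simp
next
  case (Suc m)
  then have "gsign (x + 1) = (-1) ^ Suc m" by (intro Suc.IH) auto
  with Suc.prems show ?case
    using gsign_rec[of x] by simp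
qed

lemma gsign_eq_1: "gsign x = 1" if "- 2 * real k - 2 < x" "x < - 2 * real k - 1"
  using gsign_between[of "2 * k + 1" x] that by simp

lemma gsign_eq_minus_1: "gsign x = - 1" if "- 2 * real k - 1 < x" "x < - 2 * real k"
  using gsign_between[of "2 * k" x] that by simp

end

theory Submission
  imports Defs "HOL-Real_Asymp.Real_Asymp"
begin

text \<open>
  Euler's transformation multiplies the function by a positive power of \<open>1 - x\<close> and exchanges
  the cases \<open>p + q \<ge> r\<close> and \<open>p + q \<le> r\<close>, so let \<open>p + q \<ge> r\<close>.

  If \<open>r > 0\<close>, \<open>p q < 0\<close> and \<open>F > 0\<close>, then the self-adjoint form
  \<open>(x^r (1 - x)^(p+q-r+1) F')' = p q x^(r-1) (1 - x)^(p+q-r) F\<close> of the hypergeometric equation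
  forces \<open>F' \<le> - c / (1 - x)\<close> near 1, which drives \<open>F\<close> to \<open>-\<infinity>\<close>.

  If \<open>r < 1\<close>, compare \<open>F\<close> with the other Frobenius solution
  \<open>g = x^(1-r) H\<close>, \<open>H = F(p - r + 1, q - r + 1; 2 - r)\<close>. By Abel's identity the
  Wronskian does not vanish, so \<open>F / g\<close> is monotone. For \<open>p < r - 1\<close>, positivity of \<open>F\<close>
  would make \<open>g\<close> positive, contrary to the first case applied to \<open>H\<close>.
  For \<open>p, q \<ge> r - 1\<close>, \<open>g\<close> is positive and \<open>F / g\<close> decreases, so the sign of \<open>F\<close> is decided
  near 1; there it is that of \<open>1 / (\<Gamma>(p) \<Gamma>(q) \<Gamma>(r))\<close>, because \<open>n\<close> times the \<open>n\<close>-th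
  coefficient of \<open>F\<close> is asymptotic to \<open>\<Gamma>(r) / (\<Gamma>(p) \<Gamma>(q)) n^(p+q-r)\<close>.
  If this vanishes, \<open>F\<close> is a polynomial, \<open>g\<close> is unbounded, and \<open>F / g\<close> decreases to 0.
\<close>

unbundle no vec_syntax
unbundle fps_syntax

section \<open>Hypergeometric equation and Euler transformation\<close>

definition hyp_fps :: "real \<Rightarrow> real \<Rightarrow> real \<Rightarrow> real fps" where
  "hyp_fps p q r = Abs_fps (\<lambda>n. pochhammer p n * pochhammer q n / (fact n * pochhammer r n))"

lemma eval_hyp_fps: "eval_fps (hyp_fps p q r) x = hyp2F1 p q r x"
  by (simp add: eval_fps_def hyp_fps_def hyp2F1_def)

text \<open>Gauss's hypergeometric operator, taken on formal power series so that Euler's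
  transformation reduces to ring algebra and a uniqueness argument.\<close>

definition hyp_ode :: "real \<Rightarrow> real \<Rightarrow> real \<Rightarrow> real fps \<Rightarrow> real fps" where
  "hyp_ode p q r f = fps_X * (1 - fps_X) * fps_deriv (fps_deriv f)
     + (fps_const r - fps_const (p + q + 1) * fps_X) * fps_deriv f - fps_const (p * q) * f"

lemma hyp_ode_nth:
  "hyp_ode p q r f $ n = (of_nat n + 1) * (of_nat n + r) * f $ (n + 1) - (of_nat n + p) * (of_nat n + q) * f $ n"
proof -
  have eq: "hyp_ode p q r f = fps_X * fps_deriv (fps_deriv f) - fps_X * (fps_X * fps_deriv (fps_deriv f))
     + fps_const r * fps_deriv f - fps_const (p + q + 1) * (fps_X * fps_deriv f) - fps_const (p * q) * f"
    unfolding hyp_ode_def by (simp add: algebra_simps)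
  show ?thesis
    unfolding eq by (cases n; cases "n - 1") (auto simp: algebra_simps)
qed

lemma nonpos_Ints_add_nonzero: "real n + r \<noteq> 0" if "r \<notin> \<int>\<^sub>\<le>\<^sub>0"
proof
  assume "real n + r = 0"
  then have "r = - real n" by simp
  with that show False by simp
qed

lemma hyp_fps_nth_Suc:
  assumes "r \<notin> \<int>\<^sub>\<le>\<^sub>0"
  shows "hyp_fps p q r $ Suc n
    = (real n + p) * (real n + q) / ((real n + 1) * (real n + r)) * hyp_fps p q r $ n"
proof -
  have "hyp_fps p q r $ Suc n = (pochhammer p n * pochhammer q n) * ((p + real n) * (q + real n))
     / ((fact n * pochhammer r n) * ((real n + 1) * (r + real n)))"
    by (simp add: hyp_fps_def pochhammer_Suc mult_ac add_ac)
  then show ?thesis by (simp add: hyp_fps_def add_ac mult_ac)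
qed

lemma hyp_ode_hyp_fps:
  assumes "r \<notin> \<int>\<^sub>\<le>\<^sub>0"
  shows "hyp_ode p q r (hyp_fps p q r) = 0"
proof (rule fps_ext)
  fix n
  show "hyp_ode p q r (hyp_fps p q r) $ n = 0 $ n"
    using nonpos_Ints_add_nonzero[OF assms, of n]
    by (simp add: hyp_ode_nth hyp_fps_nth_Suc[OF assms])
qed

text \<open>The equation is a two-term recurrence for the coefficients, and its leading factor
  \<open>(n + 1) * (n + r)\<close> never vanishes, so the constant term determines the
  series.\<close>

lemma hyp_ode_unique:
  assumes "r \<notin> \<int>\<^sub>\<le>\<^sub>0" "hyp_ode p q r f = 0" "f $ 0 = 1"
  shows "f = hyp_fps p q r"
proof (rule fps_ext)
  fix n
  show "f $ n = hyp_fps p q r $ n"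
  proof (induction n)
    case 0
    then show ?case using assms by (simp add: hyp_fps_def)
  next
    case (Suc n)
    have "hyp_ode p q r f $ n = 0" using assms by simp
    then have "(real n + 1) * (real n + r) * f $ Suc n = (real n + p) * (real n + q) * f $ n"
      by (simp add: hyp_ode_nth)
    then show ?case
      using nonpos_Ints_add_nonzero[OF assms(1), of n] Suc
      by (simp add: hyp_fps_nth_Suc[OF assms(1)] eq_divide_eq mult_ac)
  qed
qed

text \<open>Ratio test: the factors in the coefficient recurrence tend to 1.\<close>

lemma fps_conv_radius_hyp_fps:
  assumes "r \<notin> \<int>\<^sub>\<le>\<^sub>0"
  shows "fps_conv_radius (hyp_fps p q r) \<ge> 1"
  unfolding fps_conv_radius_def
proof (rule conv_radius_geI_ex')
  fix x :: real assume x: "0 < x" "ereal x < 1"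
  define f where "f = fps_nth (hyp_fps p q r)"
  define g where "g n = (real n + p) * (real n + q) / ((real n + 1) * (real n + r))" for n
  have "(\<lambda>n. \<bar>g n * x\<bar>) \<longlonglongrightarrow> \<bar>1 * x\<bar>"
  proof (intro tendsto_intros)
    show "g \<longlonglongrightarrow> 1" unfolding g_def by real_asymp
  qed
  moreover have "\<bar>1 * x\<bar> < (x + 1) / 2" using x by simp
  ultimately have "\<forall>\<^sub>F n in sequentially. \<bar>g n * x\<bar> < (x + 1) / 2"
    by (rule order_tendstoD)
  then obtain N where N: "\<And>n. n \<ge> N \<Longrightarrow> \<bar>g n * x\<bar> < (x + 1) / 2"
    by (auto simp: eventually_sequentially)
  show "summable (\<lambda>n. f n * of_real x ^ n)"
  proof (rule summable_ratio_test)
    show "(x + 1) / 2 < 1" using x by simp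
    fix n assume n: "n \<ge> N"
    have "norm (f (Suc n) * of_real x ^ Suc n) = \<bar>g n * x\<bar> * norm (f n * x ^ n)"
      by (simp add: f_def hyp_fps_nth_Suc[OF assms] g_def abs_mult)
    also have "\<dots> \<le> (x + 1) / 2 * norm (f n * x ^ n)"
      using N[OF n] by (intro mult_right_mono) auto
    finally show "norm (f (Suc n) * of_real x ^ Suc n) \<le> (x + 1) / 2 * norm (f n * of_real x ^ n)"
      by simp
  qed
qed

lemma norm_less_conv_radius_hyp_fps:
  fixes x :: real
  assumes "r \<notin> \<int>\<^sub>\<le>\<^sub>0" "\<bar>x\<bar> < 1"
  shows "ereal (norm x) < fps_conv_radius (hyp_fps p q r)"
  using less_le_trans[OF _ fps_conv_radius_hyp_fps[OF assms(1)], of "ereal (norm x)"] assms(2) by simp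

lemma hyp2F1_sums:
  assumes "r \<notin> \<int>\<^sub>\<le>\<^sub>0" "\<bar>x\<bar> < 1"
  shows "(\<lambda>n. hyp_fps p q r $ n * x ^ n) sums hyp2F1 p q r x"
  using sums_eval_fps[OF norm_less_conv_radius_hyp_fps[OF assms]] by (simp add: eval_hyp_fps)

lemma hyp2F1_0: "hyp2F1 p q r 0 = 1"
  by (simp add: eval_hyp_fps[symmetric] eval_fps_at_0 hyp_fps_def)

lemma hyp2F1_ode:
  assumes r: "r \<notin> \<int>\<^sub>\<le>\<^sub>0"
  shows "\<exists>F' F''. \<forall>x. \<bar>x\<bar> < 1 \<longrightarrow>
    (hyp2F1 p q r has_real_derivative F' x) (at x) \<and> (F' has_real_derivative F'' x) (at x) \<and>
    x * (1 - x) * F'' x + (r - (p + q + 1) * x) * F' x = p * q * hyp2F1 p q r x"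
proof (intro exI allI impI conjI)
  fix x :: real assume "\<bar>x\<bar> < 1"
  note x = norm_less_conv_radius_hyp_fps[OF r this, of p q]
  let ?f = "hyp_fps p q r"
  note x' = less_le_trans[OF x fps_conv_radius_deriv]
  note x'' = less_le_trans[OF x' fps_conv_radius_deriv]
  show "(hyp2F1 p q r has_real_derivative eval_fps (fps_deriv ?f) x) (at x)"
    using has_field_derivative_eval_fps[OF x, of UNIV] by (simp add: eval_hyp_fps[abs_def])
  show "(eval_fps (fps_deriv ?f) has_real_derivative eval_fps (fps_deriv (fps_deriv ?f)) x) (at x)"
    by (rule has_field_derivative_eval_fps[OF x'])
  have less_min: "a < min b c" if "a < b" "a < c" for a b c :: ereal
    using that by simp
  note rad = less_le_trans[OF less_min fps_conv_radius_mult]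
    less_le_trans[OF less_min fps_conv_radius_add]
    less_le_trans[OF less_min fps_conv_radius_diff]
  note eval_rules = eval_fps_mult eval_fps_add eval_fps_diff
  have "0 = eval_fps (hyp_ode p q r ?f) x" using hyp_ode_hyp_fps[OF r] by simp
  also have "\<dots> = x * (1 - x) * eval_fps (fps_deriv (fps_deriv ?f)) x
     + (r - (p + q + 1) * x) * eval_fps (fps_deriv ?f) x - p * q * eval_fps ?f x"
    using x x' x'' by (simp only: hyp_ode_def eval_rules rad eval_fps_const eval_fps_X eval_fps_1
      fps_conv_radius_const fps_conv_radius_fps_X fps_conv_radius_1 less_ereal.simps simp_thms)
  finally show "x * (1 - x) * eval_fps (fps_deriv (fps_deriv ?f)) x
     + (r - (p + q + 1) * x) * eval_fps (fps_deriv ?f) x = p * q * hyp2F1 p q r x"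
    by (simp add: eval_hyp_fps)
qed

section \<open>The binomial series and Euler's transformation\<close>

definition one_minus_powr_fps :: "real \<Rightarrow> real fps" where
  "one_minus_powr_fps c = Abs_fps (\<lambda>n. (-1) ^ n * (c gchoose n))"

lemma one_minus_powr_fps_sums:
  assumes "\<bar>x\<bar> < 1"
  shows "(\<lambda>n. one_minus_powr_fps c $ n * x ^ n) sums (1 - x) powr c"
  using gen_binomial_real[of "-x" c] assms
  by (simp add: one_minus_powr_fps_def power_minus' mult_ac power_minus[of x])

lemma fps_conv_radius_one_minus_powr: "fps_conv_radius (one_minus_powr_fps c) \<ge> 1"
  unfolding fps_conv_radius_def
proof (rule conv_radius_geI_ex')
  fix x :: real assume x: "0 < x" "ereal x < 1"
  then show "summable (\<lambda>n. one_minus_powr_fps c $ n * of_real x ^ n)"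
    using one_minus_powr_fps_sums[of x c] by (auto intro: sums_summable)
qed

text \<open>The formal first-order equation of \<open>(1 - x) powr c\<close>, by which Euler's
  transformation eliminates the derivatives of this factor.\<close>

lemma one_minus_powr_fps_deriv:
  "(1 - fps_X) * fps_deriv (one_minus_powr_fps c) = - fps_const c * one_minus_powr_fps c"
proof (rule fps_ext)
  fix n
  have eq: "(real n + 1) * (c gchoose Suc n) = (c - real n) * (c gchoose n)" for n
    using gbinomial_mult_1[of c n] by (simp add: algebra_simps)
  have nth: "((1 - fps_X) * fps_deriv f) $ n = (real n + 1) * f $ Suc n - real n * f $ n" for f :: "real fps"
    by (cases n) (auto simp: left_diff_distrib add_ac)
  have "(real n + 1) * ((-1) ^ Suc n * (c gchoose Suc n)) = - ((-1) ^ n) * ((real n + 1) * (c gchoose Suc n))"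
    by simp
  also have "\<dots> = - ((-1) ^ n) * ((c - real n) * (c gchoose n))"
    unfolding eq ..
  finally show "((1 - fps_X) * fps_deriv (one_minus_powr_fps c)) $ n = (- fps_const c * one_minus_powr_fps c) $ n"
    unfolding nth by (simp add: one_minus_powr_fps_def algebra_simps)
qed

text \<open>The product solves the hypergeometric equation with parameters \<open>r - p\<close>,
  \<open>r - q\<close>, \<open>r\<close> and has constant term 1, so uniqueness identifies
  it.\<close>

lemma euler_transformation_fps:
  assumes r: "r \<notin> \<int>\<^sub>\<le>\<^sub>0"
  shows "one_minus_powr_fps (p + q - r) * hyp_fps p q r = hyp_fps (r - p) (r - q) r"
proof (rule hyp_ode_unique[OF r])
  let ?c = "p + q - r"
  let ?B = "one_minus_powr_fps ?c" and ?A = "hyp_fps p q r"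
  let ?C = "fps_const :: real \<Rightarrow> real fps"
  show "(?B * ?A) $ 0 = 1" by (simp add: one_minus_powr_fps_def hyp_fps_def)
  define B A where "B = ?B" and "A = ?A"
  define P Q R where "P = ?C p" and "Q = ?C q" and "R = ?C r"
  define S where "S = P + Q - R"
  define B1 A1 A2 where "B1 = fps_deriv B" and "A1 = fps_deriv A" and "A2 = fps_deriv A1"
  define f where "f = B * A"
  define f1 f2 where "f1 = fps_deriv f" and "f2 = fps_deriv f1"
  define Y :: "real fps" where "Y = 1 - fps_X"
  have c: "?C ?c = S" by (simp add: S_def P_def Q_def R_def)
  have B1: "Y * B1 = - S * B"
    using one_minus_powr_fps_deriv[of ?c] by (simp add: c B_def B1_def Y_def)
  have A: "(1 - Y) * Y * A2 + (R - (P + Q + 1) * (1 - Y)) * A1 - P * Q * A = 0"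
    using hyp_ode_hyp_fps[OF r, of p q]
    by (simp add: hyp_ode_def A_def A1_def A2_def P_def Q_def R_def Y_def flip: fps_const_1_eq_1)
  have dY: "fps_deriv Y = - 1" by (simp add: Y_def)
  have dS: "fps_deriv S = 0" by (simp add: S_def P_def Q_def R_def)
  have f1_eq: "f1 = B1 * A + B * A1"
    by (simp add: f1_def f_def A1_def B1_def algebra_simps)
  have "Y * f1 = (Y * B1) * A + Y * B * A1"
    unfolding f1_eq by (simp add: algebra_simps)
  also have "\<dots> = B * (Y * A1 - S * A)"
    unfolding B1 by (simp add: algebra_simps)
  finally have f1: "Y * f1 = B * (Y * A1 - S * A)" .
  have "Y * f2 - f1 = fps_deriv (Y * f1)"
    by (simp add: f2_def dY)
  also have "\<dots> = B1 * (Y * A1 - S * A) + B * (Y * A2 - A1 - S * A1)"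
    unfolding f1 fps_deriv_mult fps_deriv_sub dY dS A1_def[symmetric] A2_def[symmetric] B1_def[symmetric]
    by (simp add: algebra_simps)
  finally have "Y * f2 = f1 + (B1 * (Y * A1 - S * A) + B * (Y * A2 - A1 - S * A1))"
    by (simp add: diff_eq_eq add_ac)
  then have "Y * (Y * f2) = Y * (f1 + (B1 * (Y * A1 - S * A) + B * (Y * A2 - A1 - S * A1)))"
    by simp
  then have "Y * (Y * f2) = Y * f1 + (Y * B1) * (Y * A1 - S * A)
      + Y * B * (Y * A2 - A1 - S * A1)"
    by (simp add: algebra_simps)
  then have f2: "Y * (Y * f2) = B * ((1 - S) * (Y * A1 - S * A)
      + Y * (Y * A2 - A1 - S * A1))"
    unfolding f1 B1 by (simp add: algebra_simps)
  \<comment> \<open>\<open>f1\<close> and \<open>f2\<close> are known only after multiplication by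
    \<open>Y\<close> and \<open>Y * Y\<close>. Hence the equation is first proved times
    \<open>Y\<close>, which is then cancelled in the integral domain of power series.\<close>
  have "Y * ((1 - Y) * Y * f2 + (R - ((R - P) + (R - Q) + 1) * (1 - Y)) * f1 - (R - P) * (R - Q) * f)
      = (1 - Y) * (Y * (Y * f2)) + (R - ((R - P) + (R - Q) + 1) * (1 - Y)) * (Y * f1)
        - (R - P) * (R - Q) * Y * (B * A)"
    by (simp add: f_def algebra_simps)
  also have "\<dots> = B * Y * ((1 - Y) * Y * A2 + (R - (P + Q + 1) * (1 - Y)) * A1 - P * Q * A)"
    unfolding f1 f2 S_def by algebra
  finally have "Y * ((1 - Y) * Y * f2 + (R - ((R - P) + (R - Q) + 1) * (1 - Y)) * f1 - (R - P) * (R - Q) * f) = 0"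
    unfolding A by simp
  moreover have "Y \<noteq> 0"
  proof
    assume "Y = 0"
    then have "Y $ 0 = 0" by simp
    then show False by (simp add: Y_def)
  qed
  ultimately have "(1 - Y) * Y * f2 + (R - ((R - P) + (R - Q) + 1) * (1 - Y)) * f1 - (R - P) * (R - Q) * f = 0"
    by simp
  then show "hyp_ode (r - p) (r - q) r (?B * ?A) = 0"
    by (simp add: hyp_ode_def f_def B_def A_def f1_def f2_def P_def Q_def R_def Y_def
        flip: fps_const_1_eq_1)
qed

lemma euler_transformation:
  assumes r: "r \<notin> \<int>\<^sub>\<le>\<^sub>0" and x: "\<bar>x\<bar> < 1"
  shows "(1 - x) powr (p + q - r) * hyp2F1 p q r x = hyp2F1 (r - p) (r - q) r x"
proof -
  have "ereal (norm x) < fps_conv_radius (one_minus_powr_fps (p + q - r))"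
    using less_le_trans[OF _ fps_conv_radius_one_minus_powr, of "ereal (norm x)"] x by simp
  from eval_fps_mult[OF this norm_less_conv_radius_hyp_fps[OF r x, of p q]] show ?thesis
    using one_minus_powr_fps_sums[OF x, of "p + q - r"]
    by (simp add: euler_transformation_fps[OF r] eval_hyp_fps) (simp add: eval_fps_def sums_iff)
qed

section \<open>Self-adjoint form, Wronskian and behaviour near 1\<close>

text \<open>Were the function positive, the weighted derivative \<open>u\<close> of the self-adjoint
  form would start at 0 and decrease. This bounds \<open>F1\<close> by a negative multiple of
  \<open>1 / (1 - x)\<close>, and integration yields a logarithm tending to minus infinity.\<close>

lemma hyp2F1_nonpos_if_opposite_signs:
  fixes p q r :: real
  assumes r: "r > 0" and pq: "p * q < 0" and d: "p + q \<ge> r"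
  shows "\<exists>x\<in>{0<..<1}. hyp2F1 p q r x \<le> 0"
proof (rule ccontr)
  assume "\<not> ?thesis"
  then have pos: "hyp2F1 p q r x > 0" if "0 < x" "x < 1" for x
    using that by (auto simp: not_le)
  have "r \<notin> \<int>\<^sub>\<le>\<^sub>0" using r by auto
  then obtain F1 F2 where F:
    "\<And>x. \<bar>x\<bar> < 1 \<Longrightarrow> (hyp2F1 p q r has_real_derivative F1 x) (at x)"
    "\<And>x. \<bar>x\<bar> < 1 \<Longrightarrow> (F1 has_real_derivative F2 x) (at x)"
    "\<And>x. \<bar>x\<bar> < 1 \<Longrightarrow> x * (1 - x) * F2 x + (r - (p + q + 1) * x) * F1 x = p * q * hyp2F1 p q r x"
    using hyp2F1_ode[of r p q] by blast
  define \<delta> where "\<delta> = p + q - r"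
  define u where "u x = x powr r * (1 - x) powr (\<delta> + 1) * F1 x" for x
  have u_deriv: "(u has_real_derivative p * q * x powr (r - 1) * (1 - x) powr \<delta> * hyp2F1 p q r x) (at x)"
    if x: "0 < x" "x < 1" for x
  proof -
    have "(u has_real_derivative
        (r * x powr (r - 1) * (1 - x) powr (\<delta> + 1) - x powr r * ((\<delta> + 1) * (1 - x) powr \<delta>)) * F1 x
         + x powr r * (1 - x) powr (\<delta> + 1) * F2 x) (at x)"
      unfolding u_def[abs_def] using x
      by (auto intro!: derivative_eq_intros F(2) simp: algebra_simps)
    also have "(r * x powr (r - 1) * (1 - x) powr (\<delta> + 1) - x powr r * ((\<delta> + 1) * (1 - x) powr \<delta>)) * F1 x
         + x powr r * (1 - x) powr (\<delta> + 1) * F2 x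
       = x powr (r - 1) * (1 - x) powr \<delta> * (x * (1 - x) * F2 x + (r - (p + q + 1) * x) * F1 x)"
    proof -
      have e1: "x powr r = x powr (r - 1) * x"
        using x by (simp add: powr_diff)
      have e2: "(1 - x) powr (\<delta> + 1) = (1 - x) powr \<delta> * (1 - x)"
        using x by (simp add: powr_add)
      have e3: "p + q + 1 = \<delta> + 1 + r" by (simp add: \<delta>_def)
      show ?thesis unfolding e1 e2 e3 by (simp add: algebra_simps)
    qed
    also have "\<dots> = p * q * x powr (r - 1) * (1 - x) powr \<delta> * hyp2F1 p q r x"
      using F(3)[of x] x by simp
    finally show ?thesis .
  qed
  have u_cont: "continuous_on {a..b} u" if "0 \<le> a" "b < 1" for a b
  proof -
    have "continuous_on {a..b} F1"
      using that by (intro DERIV_continuous_on[of _ _ F2] DERIV_subset[OF F(2)]) auto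
    then show ?thesis
      unfolding u_def[abs_def] using that r
      by (intro continuous_intros continuous_on_powr') auto
  qed
  have u_decr: "u b < u a" if "0 \<le> a" "a < b" "b < 1" for a b
  proof (rule DERIV_neg_imp_decreasing_open[OF that(2)])
    show "continuous_on {a..b} u" using u_cont that by simp
    fix x assume "a < x" "x < b"
    then have x: "0 < x" "x < 1" using that by auto
    show "\<exists>y. (u has_real_derivative y) (at x) \<and> y < 0"
      using u_deriv[OF x] pos[OF x] pq x by (intro exI conjI) (auto simp: mult_less_0_iff)
  qed
  define c where "c = - u (1 / 2)"
  have "c > 0" using u_decr[of 0 "1/2"] by (simp add: c_def u_def)
  have F1_le: "F1 x \<le> - c / (1 - x)" if x: "1 / 2 \<le> x" "x < 1" for x
  proof -
    have ux: "u x \<le> - c"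
    proof (cases "x = 1 / 2")
      case True
      then show ?thesis unfolding c_def True by simp
    next
      case False
      then show ?thesis using u_decr[of "1/2" x] x by (simp add: c_def)
    qed
    \<comment> \<open>Here \<open>p + q \<ge> r\<close> enters: the weight is at most 1, so removing
      it from the negative quantity \<open>u x\<close> leaves something at most
      \<open>u x\<close>.\<close>
    have w: "0 < x powr r * (1 - x) powr \<delta>" "x powr r * (1 - x) powr \<delta> \<le> 1"
      using x r d by (auto intro!: mult_le_one powr_le1 simp: \<delta>_def)
    have ux': "u x = x powr r * (1 - x) powr \<delta> * ((1 - x) * F1 x)"
      using x by (simp add: u_def powr_add)
    have "(1 - x) * F1 x < 0"
      using ux \<open>c > 0\<close> w(1) unfolding ux' by (smt (verit) mult_nonneg_nonneg)
    then have "(1 - x) * F1 x \<le> u x"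
      unfolding ux' using w(2) mult_right_mono_neg[of "x powr r * (1 - x) powr \<delta>" 1 "(1 - x) * F1 x"] by simp
    then show ?thesis using ux x by (simp add: field_simps)
  qed
  define m where "m = hyp2F1 p q r (1 / 2) - c * ln (1 / 2)"
  have F_le: "hyp2F1 p q r x - c * ln (1 - x) \<le> m" if x: "1 / 2 \<le> x" "x < 1" for x
  proof -
    have "hyp2F1 p q r x - c * ln (1 - x) \<le> hyp2F1 p q r (1/2) - c * ln (1 - 1/2)"
    proof (rule DERIV_nonpos_imp_nonincreasing[OF x(1)])
      fix y assume y: "1 / 2 \<le> y" "y \<le> x"
      then show "\<exists>z. ((\<lambda>x. hyp2F1 p q r x - c * ln (1 - x)) has_real_derivative z) (at y) \<and> z \<le> 0"
        using x F1_le[of y]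
        by (intro exI[of _ "F1 y + c / (1 - y)"] conjI)
           (auto intro!: derivative_eq_intros F(1) simp: field_simps)
    qed
    then show ?thesis by (simp add: m_def)
  qed
  \<comment> \<open>At \<open>x = 1 - exp (- t)\<close> the logarithm \<open>ln (1 - x)\<close> is
    \<open>- t\<close>. The bound \<open>t \<ge> m / c\<close> makes the function nonpositive there,
    and \<open>t \<ge> 1\<close> keeps \<open>x\<close> above 1/2.\<close>
  define t where "t = max 1 (m / c)"
  have "exp (- t) \<le> exp (- 1)" by (simp add: t_def)
  also have "\<dots> \<le> 1 / (2 :: real)"
    using exp_ge_add_one_self[of 1] by (simp add: exp_minus field_simps)
  finally have t: "1 / 2 \<le> 1 - exp (- t)" by simp
  have "m / c \<le> t" by (simp add: t_def)
  then have "m \<le> c * t" using \<open>c > 0\<close> by (simp add: field_simps)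
  moreover have "t > 0" by (simp add: t_def)
  ultimately show False using F_le[OF t] pos[of "1 - exp (- t)"] t by simp
qed

text \<open>The positive quantity is \<open>x powr r\<close> times the Wronskian of \<open>F\<close> and \<open>x powr (1 - r) * H\<close>, which is
  smooth at 0.\<close>

lemma hyp2F1_wronskian:
  fixes p q r :: real
  assumes r: "r \<notin> \<int>\<^sub>\<le>\<^sub>0" and r1: "r < 1"
  obtains F' H' where
    "\<And>x. \<bar>x\<bar> < 1 \<Longrightarrow> (hyp2F1 p q r has_real_derivative F' x) (at x)"
    "\<And>x. \<bar>x\<bar> < 1 \<Longrightarrow> (hyp2F1 (p - r + 1) (q - r + 1) (2 - r) has_real_derivative H' x) (at x)"
    "\<And>x. 0 \<le> x \<Longrightarrow> x < 1 \<Longrightarrow>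
      hyp2F1 p q r x * ((1 - r) * hyp2F1 (p - r + 1) (q - r + 1) (2 - r) x + x * H' x)
       - x * F' x * hyp2F1 (p - r + 1) (q - r + 1) (2 - r) x > 0"
proof -
  define F H where "F = hyp2F1 p q r" and "H = hyp2F1 (p - r + 1) (q - r + 1) (2 - r)"
  obtain F1 F2 where F:
    "\<And>x. \<bar>x\<bar> < 1 \<Longrightarrow> (F has_real_derivative F1 x) (at x)"
    "\<And>x. \<bar>x\<bar> < 1 \<Longrightarrow> (F1 has_real_derivative F2 x) (at x)"
    "\<And>x. \<bar>x\<bar> < 1 \<Longrightarrow> x * (1 - x) * F2 x + (r - (p + q + 1) * x) * F1 x = p * q * F x"
    unfolding F_def using hyp2F1_ode[OF r, of p q] by blast
  have r': "2 - r \<notin> \<int>\<^sub>\<le>\<^sub>0" using r1 by auto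
  obtain H1 H2 where H:
    "\<And>x. \<bar>x\<bar> < 1 \<Longrightarrow> (H has_real_derivative H1 x) (at x)"
    "\<And>x. \<bar>x\<bar> < 1 \<Longrightarrow> (H1 has_real_derivative H2 x) (at x)"
    "\<And>x. \<bar>x\<bar> < 1 \<Longrightarrow> x * (1 - x) * H2 x + ((2 - r) - ((p - r + 1) + (q - r + 1) + 1) * x) * H1 x
        = (p - r + 1) * (q - r + 1) * H x"
    unfolding H_def using hyp2F1_ode[OF r', of "p - r + 1" "q - r + 1"] by blast
  define \<delta> where "\<delta> = p + q - r"
  define K where "K x = F x * ((1 - r) * H x + x * H1 x) - x * F1 x * H x" for x
  \<comment> \<open>Abel's identity: \<open>V\<close> is constant.\<close>
  define V where "V x = (1 - x) powr (\<delta> + 1) * K x" for x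
  have V_deriv: "(V has_real_derivative 0) (at x)" if x: "\<bar>x\<bar> < 1" for x
  proof -
    define K' where "K' = F x * ((2 - r) * H1 x + x * H2 x) - r * F1 x * H x - x * F2 x * H x"
    have "(K has_real_derivative K') (at x)"
      unfolding K_def[abs_def] K'_def
      by (auto intro!: derivative_eq_intros F H x simp: algebra_simps)
    then have "(V has_real_derivative
        (1 - x) powr (\<delta> + 1) * K' - (\<delta> + 1) * (1 - x) powr \<delta> * K x) (at x)"
      unfolding V_def[abs_def] using x
      by (auto intro!: derivative_eq_intros simp: algebra_simps)
    also have "(1 - x) powr (\<delta> + 1) = (1 - x) powr \<delta> * (1 - x)"
      using x by (simp add: powr_add)
    also have "(1 - x) powr \<delta> * (1 - x) * K' - (\<delta> + 1) * (1 - x) powr \<delta> * K x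
        = (1 - x) powr \<delta> * ((1 - x) * K' - (\<delta> + 1) * K x)"
      by (simp add: algebra_simps)
    \<comment> \<open>\<open>F\<close> times the equation of \<open>H\<close> minus \<open>H\<close>
      times the equation of \<open>F\<close> removes the second derivatives.\<close>
    also have "(1 - x) * K' - (\<delta> + 1) * K x = 0"
      using F(3)[OF x] H(3)[OF x] unfolding K'_def K_def \<delta>_def by algebra
    finally show ?thesis by simp
  qed
  have K_pos: "K x > 0" if x: "0 \<le> x" "x < 1" for x
  proof -
    \<comment> \<open>At 0 both functions equal 1, so the constant is \<open>1 - r\<close>, which is
      positive.\<close>
    have "V x = V 0"
      by (rule DERIV_isconst3[of "-1" 1]) (use x V_deriv in auto)
    also have "V 0 = 1 - r" by (simp add: V_def K_def F_def H_def hyp2F1_0)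
    finally have "(1 - x) powr (\<delta> + 1) * K x > 0" using r1 by (simp add: V_def)
    then show ?thesis using x by (simp add: zero_less_mult_iff)
  qed
  show ?thesis
    by (rule that[OF F(1)[unfolded F_def] H(1)[unfolded H_def] K_pos[unfolded K_def F_def H_def]])
qed

section \<open>Divergence at 1 from the growth of the coefficients\<close>

text \<open>Comparison with \<open>c\<close> times the series of \<open>- ln (1 - x)\<close>: from
  some index on the difference has nonnegative coefficients, and the finitely many earlier terms are
  bounded.\<close>

lemma suminf_powser_at_top:
  fixes f :: "nat \<Rightarrow> real"
  assumes summable: "\<And>x. 0 < x \<Longrightarrow> x < 1 \<Longrightarrow> summable (\<lambda>n. f n * x ^ n)"
    and c: "c > 0" and f: "\<forall>\<^sub>F n in sequentially. c \<le> f n * real n"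
  shows "filterlim (\<lambda>x. \<Sum>n. f n * x ^ n) at_top (at_left 1)"
proof -
  have "\<forall>\<^sub>F n in sequentially. c \<le> f n * real n \<and> n > 0"
    using f eventually_gt_at_top[of 0] by eventually_elim auto
  then obtain N where N: "\<And>n. n \<ge> N \<Longrightarrow> c \<le> f n * real n \<and> n > 0"
    by (auto simp: eventually_sequentially)
  \<comment> \<open>At \<open>n = 0\<close> division by zero gives 0, which matches the absent
    constant term of the logarithmic series.\<close>
  define e where "e n = f n - c / real n" for n
  have e_nonneg: "e n \<ge> 0" if "n \<ge> N" for n
    using N[OF that] by (simp add: e_def field_simps)
  define B where "B = (\<Sum>n<N. \<bar>e n\<bar>)"
  have le: "- c * ln (1 - x) - B \<le> (\<Sum>n. f n * x ^ n)" if x: "0 < x" "x < 1" for x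
  proof -
    have sums: "(\<lambda>n. f n * x ^ n + c * (- (x ^ n) / real n)) sums ((\<Sum>n. f n * x ^ n) + c * ln (1 - x))"
      using ln_series'[of "-x"] x
      by (intro sums_add sums_mult summable_sums summable) auto
    have sums': "(\<lambda>n. if n \<in> {..<N} then - \<bar>e n\<bar> else 0) sums (\<Sum>n<N. - \<bar>e n\<bar>)"
      by (rule sums_If_finite_set) auto
    have "(if n \<in> {..<N} then - \<bar>e n\<bar> else 0) \<le> f n * x ^ n + c * (- (x ^ n) / real n)" for n
    proof -
      have eq: "f n * x ^ n + c * (- (x ^ n) / real n) = e n * x ^ n"
        by (simp add: e_def algebra_simps)
      have "x ^ n \<le> 1" using x by (intro power_le_one) auto
      then have "\<bar>e n\<bar> * x ^ n \<le> \<bar>e n\<bar>" by (simp add: mult_left_le)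
      moreover have "- (\<bar>e n\<bar> * x ^ n) \<le> e n * x ^ n"
        using x mult_right_mono[of "- \<bar>e n\<bar>" "e n" "x ^ n"] by simp
      ultimately show ?thesis
        unfolding eq using e_nonneg[of n] x by auto
    qed
    then have "(\<Sum>n<N. - \<bar>e n\<bar>) \<le> (\<Sum>n. f n * x ^ n) + c * ln (1 - x)"
      using sums' sums by (rule sums_le)
    then show ?thesis by (simp add: B_def sum_negf)
  qed
  have "filterlim (\<lambda>x. - c * ln (1 - x) - B) at_top (at_left 1)"
    using c by real_asymp
  moreover have "\<forall>\<^sub>F x in at_left 1. - c * ln (1 - x) - B \<le> (\<Sum>n. f n * x ^ n)"
    using eventually_at_left_real[OF zero_less_one] by eventually_elim (use le in auto)
  ultimately show ?thesis by (rule filterlim_at_top_mono)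
qed

text \<open>\<open>L\<close> is the limit of a quotient of Euler products for 1/Gamma, and
  \<open>n\<close> times the coefficient is this quotient times a power with exponent
  \<open>p + q - r \<ge> 0\<close>. Halving \<open>L\<close> absorbs the error of the limit; for
  \<open>L = 0\<close> both sides vanish.\<close>

lemma hyp_fps_coeff_lower_bound:
  fixes p q r :: real
  assumes r: "r \<notin> \<int>\<^sub>\<le>\<^sub>0" and d: "p + q \<ge> r"
    and L: "L = rGamma p * rGamma q / rGamma r"
  shows "\<forall>\<^sub>F n in sequentially. \<bar>L\<bar> / 2 \<le> sgn L * hyp_fps p q r $ n * real n"
proof (cases "L = 0")
  case False
  define \<rho> where "\<rho> n = rGamma_series p n * rGamma_series q n / rGamma_series r n" for n
  have "rGamma r \<noteq> 0" using r by (simp add: rGamma_eq_zero_iff)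
  then have "(\<lambda>n. sgn L * \<rho> n) \<longlonglongrightarrow> sgn L * L"
    unfolding \<rho>_def L by (intro tendsto_intros)
  moreover have "sgn L * L > \<bar>L\<bar> / 2" using False by (simp add: sgn_mult_self_eq abs_sgn[symmetric] mult.commute)
  ultimately have "\<forall>\<^sub>F n in sequentially. \<bar>L\<bar> / 2 < sgn L * \<rho> n"
    by (rule order_tendstoD)
  \<comment> \<open>The index is shifted because \<open>rGamma_series z n\<close> contains
    \<open>pochhammer z (n + 1)\<close>.\<close>
  then have "\<forall>\<^sub>F n in sequentially. \<bar>L\<bar> / 2 \<le> sgn L * hyp_fps p q r $ Suc n * real (Suc n)"
    using eventually_gt_at_top[of 0]
  proof eventually_elim
    case (elim n)
    have "hyp_fps p q r $ Suc n * real (Suc n) = pochhammer p (n + 1) * pochhammer q (n + 1) / (fact n * pochhammer r (n + 1))"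
      by (simp add: hyp_fps_def fact_Suc del: of_nat_Suc)
    also have "\<dots> = \<rho> n * exp ((p + q - r) * ln (real n))"
      by (simp add: \<rho>_def rGamma_series_def exp_add exp_diff left_diff_distrib distrib_right)
    finally have eq: "hyp_fps p q r $ Suc n * real (Suc n) = \<rho> n * exp ((p + q - r) * ln (real n))" .
    have "1 \<le> exp ((p + q - r) * ln (real n))" using d elim by simp
    then have "sgn L * \<rho> n * 1 \<le> sgn L * \<rho> n * exp ((p + q - r) * ln (real n))"
      using elim by (intro mult_left_mono) auto
    with elim eq show ?case by (simp add: mult.assoc)
  qed
  then show ?thesis by (subst (asm) eventually_sequentially_Suc)
qed auto

text \<open>The sign product is the sign of \<open>L\<close>; multiplying by it treats divergence to
  plus and to minus infinity at once.\<close>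

lemma hyp2F1_at_left_1:
  fixes p q r :: real
  assumes r: "r \<notin> \<int>\<^sub>\<le>\<^sub>0" and d: "p + q \<ge> r"
    and s: "gsign p * gsign q * gsign r \<noteq> 0"
  shows "filterlim (\<lambda>x. gsign p * gsign q * gsign r * hyp2F1 p q r x) at_top (at_left 1)"
proof -
  define L where "L = rGamma p * rGamma q / rGamma r"
  have sgn_L: "sgn L = gsign p * gsign q * gsign r"
    by (simp add: L_def gsign_def sgn_mult divide_inverse)
  with s have "L \<noteq> 0" by auto
  have eq: "gsign p * gsign q * gsign r * hyp2F1 p q r x = (\<Sum>n. (sgn L * hyp_fps p q r $ n) * x ^ n)"
    and summable: "summable (\<lambda>n. (sgn L * hyp_fps p q r $ n) * x ^ n)" if "0 < x" "x < 1" for x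
    using sums_mult[OF hyp2F1_sums[OF r], of x "sgn L"] that
    by (auto simp: sums_iff sgn_L mult.assoc)
  have "filterlim (\<lambda>x. \<Sum>n. (sgn L * hyp_fps p q r $ n) * x ^ n) at_top (at_left 1)"
    using hyp_fps_coeff_lower_bound[OF r d L_def] \<open>L \<noteq> 0\<close>
    by (intro suminf_powser_at_top[of _ "\<bar>L\<bar> / 2"] summable) auto
  moreover have "\<forall>\<^sub>F x in at_left 1. (\<Sum>n. (sgn L * hyp_fps p q r $ n) * x ^ n)
      = gsign p * gsign q * gsign r * hyp2F1 p q r x"
    using eventually_at_left_real[OF zero_less_one] by eventually_elim (auto simp: eq)
  ultimately show ?thesis
    using filterlim_cong[OF refl refl] by force
qed

section \<open>Positivity\<close>

lemma hyp2F1_commute: "hyp2F1 p q r = hyp2F1 q p r"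
  by (simp add: hyp2F1_def[abs_def] mult.commute)

text \<open>All coefficients are nonnegative and the constant term is 1.\<close>

lemma hyp2F1_ge_1:
  assumes "p \<ge> 0" "q \<ge> 0" "r > 0" "0 \<le> x" "x < 1"
  shows "hyp2F1 p q r x \<ge> 1"
proof -
  have "r \<notin> \<int>\<^sub>\<le>\<^sub>0" using assms by auto
  then have sums: "(\<lambda>n. hyp_fps p q r $ n * x ^ n) sums hyp2F1 p q r x"
    using assms by (intro hyp2F1_sums) auto
  have "pochhammer a n \<ge> 0" if "a \<ge> 0" for a :: real and n
    using that by (auto simp: pochhammer_prod intro!: prod_nonneg)
  then have "(\<Sum>n<1. hyp_fps p q r $ n * x ^ n) \<le> hyp2F1 p q r x"
    using assms unfolding sums_unique[OF sums]
    by (intro sum_le_suminf[OF sums_summable[OF sums]])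
       (auto simp: hyp_fps_def intro!: mult_nonneg_nonneg divide_nonneg_pos mult_pos_pos pochhammer_pos)
  then show ?thesis by (simp add: hyp_fps_def)
qed

lemma hyp2F1_polynomial_bounded:
  assumes "p \<in> \<int>\<^sub>\<le>\<^sub>0"
  shows "\<exists>B. \<forall>x. 0 < x \<longrightarrow> x < 1 \<longrightarrow> \<bar>hyp2F1 p q r x\<bar> \<le> B"
proof -
  from assms obtain m where m: "p = - real m" by (auto elim: nonpos_Ints_cases')
  define a where "a n = pochhammer p n * pochhammer q n / (fact n * pochhammer r n)" for n
  have eq: "hyp2F1 p q r x = (\<Sum>n\<le>m. a n * x ^ n)" for x
    unfolding hyp2F1_def a_def by (rule suminf_finite) (auto simp: m pochhammer_of_nat_eq_0_iff)
  have "\<bar>hyp2F1 p q r x\<bar> \<le> (\<Sum>n\<le>m. \<bar>a n\<bar>)" if "0 < x" "x < 1" for x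
  proof -
    have "\<bar>hyp2F1 p q r x\<bar> \<le> (\<Sum>n\<le>m. \<bar>a n * x ^ n\<bar>)"
      unfolding eq by (rule sum_abs)
    also have "\<dots> \<le> (\<Sum>n\<le>m. \<bar>a n\<bar>)"
      using that by (intro sum_mono) (auto simp: abs_mult intro!: mult_left_le power_le_one)
    finally show ?thesis .
  qed
  then show ?thesis by blast
qed

lemma at_left_1_witness:
  assumes "\<forall>\<^sub>F x in at_left (1 :: real). P x" "a < 1"
  obtains x where "a < x" "x < 1" "P x"
proof -
  have "\<forall>\<^sub>F x in at_left 1. P x \<and> x \<in> {a<..<1}"
    using assms(1) eventually_at_left_real[OF assms(2)] by eventually_elim auto
  then obtain x where "P x \<and> x \<in> {a<..<1}"
    using eventually_happens[of _ "at_left (1 :: real)"] by (auto simp: trivial_limit_at_left_real)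
  with that show ?thesis by auto
qed

section \<open>The range \<open>r < 1\<close>: comparison with the second Frobenius solution\<close>

lemma hyp2F1_pos_imp_ge:
  fixes p q r :: real
  assumes r: "r \<notin> \<int>\<^sub>\<le>\<^sub>0" and r1: "r < 1" and d: "p + q \<ge> r"
    and pos: "\<And>x. 0 < x \<Longrightarrow> x < 1 \<Longrightarrow> hyp2F1 p q r x > 0"
  shows "p \<ge> r - 1"
proof (rule ccontr)
  assume p: "\<not> p \<ge> r - 1"
  define F where "F = hyp2F1 p q r"
  define H where "H = hyp2F1 (p - r + 1) (q - r + 1) (2 - r)"
  have "(p - r + 1) * (q - r + 1) < 0"
    using p d r1 by (intro mult_neg_pos) auto
  then obtain x where x: "0 < x" "x < 1" and Hx: "H x \<le> 0"
    using hyp2F1_nonpos_if_opposite_signs[of "2 - r" "p - r + 1" "q - r + 1"] d r1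
    by (auto simp: H_def)
  obtain F' H' where
    F': "\<And>x. \<bar>x\<bar> < 1 \<Longrightarrow> (F has_real_derivative F' x) (at x)" and
    H': "\<And>x. \<bar>x\<bar> < 1 \<Longrightarrow> (H has_real_derivative H' x) (at x)" and
    W: "\<And>x. 0 \<le> x \<Longrightarrow> x < 1 \<Longrightarrow> F x * ((1 - r) * H x + x * H' x) - x * F' x * H x > 0"
    unfolding F_def H_def by (rule hyp2F1_wronskian[OF r r1, of p q]) blast
  \<comment> \<open>The quotient vanishes at 0, and its derivative has the sign of the Wronskian. It
    therefore increases and is positive at \<open>x\<close>, against
    \<open>H x \<le> 0\<close>.\<close>
  define \<psi> where "\<psi> x = x powr (1 - r) * H x / F x" for x
  have F_pos: "F y > 0" if "0 \<le> y" "y < 1" for y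
    using that pos[of y] by (cases "y = 0") (auto simp: F_def hyp2F1_0)
  have "\<psi> 0 < \<psi> x"
  proof (rule DERIV_pos_imp_increasing_open[OF x(1)])
    have "continuous_on {0..x} F" "continuous_on {0..x} H"
      using x by (auto intro!: DERIV_continuous_on DERIV_subset[OF F'] DERIV_subset[OF H'])
    then show "continuous_on {0..x} \<psi>"
      unfolding \<psi>_def[abs_def] using x r1 F_pos
      by (intro continuous_intros continuous_on_powr') (auto simp: less_imp_neq[symmetric] order.strict_iff_not)
    fix y assume "0 < y" "y < x"
    then have y: "0 < y" "y < 1" using x by auto
    have "(\<psi> has_real_derivative
        (((1 - r) * y powr (- r) * H y + y powr (1 - r) * H' y) * F y - y powr (1 - r) * H y * F' y) / (F y * F y)) (at y)"
      unfolding \<psi>_def[abs_def] using y F_pos[of y]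
      by (auto intro!: derivative_eq_intros F' H')
    also have "((1 - r) * y powr (- r) * H y + y powr (1 - r) * H' y) * F y - y powr (1 - r) * H y * F' y
        = y powr (- r) * (F y * ((1 - r) * H y + y * H' y) - y * F' y * H y)"
    proof -
      have e: "y powr (1 - r) = y powr (- r) * y"
        using y by (simp add: powr_diff powr_minus divide_inverse)
      show ?thesis unfolding e by (simp add: algebra_simps)
    qed
    finally show "\<exists>z. (\<psi> has_real_derivative z) (at y) \<and> z > 0"
      using W[of y] F_pos[of y] y by (intro exI conjI) (assumption, auto)
  qed
  with Hx F_pos[of x] x show False
    by (auto simp: \<psi>_def zero_less_divide_iff zero_less_mult_iff)
qed

lemma hyp2F1_pos_if:
  fixes p q r :: real
  assumes r: "r \<notin> \<int>\<^sub>\<le>\<^sub>0" and r1: "r < 1" and d: "p + q \<ge> r"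
    and p: "p \<ge> r - 1" and q: "q \<ge> r - 1" and s: "gsign p * gsign q * gsign r \<ge> 0"
    and x: "0 < x" "x < 1"
  shows "hyp2F1 p q r x > 0"
proof (rule ccontr)
  define F where "F = hyp2F1 p q r"
  define H where "H = hyp2F1 (p - r + 1) (q - r + 1) (2 - r)"
  assume "\<not> hyp2F1 p q r x > 0"
  then have Fx: "F x \<le> 0" by (simp add: F_def)
  obtain F' H' where
    F': "\<And>x. \<bar>x\<bar> < 1 \<Longrightarrow> (F has_real_derivative F' x) (at x)" and
    H': "\<And>x. \<bar>x\<bar> < 1 \<Longrightarrow> (H has_real_derivative H' x) (at x)" and
    W: "\<And>x. 0 \<le> x \<Longrightarrow> x < 1 \<Longrightarrow> F x * ((1 - r) * H x + x * H' x) - x * F' x * H x > 0"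
    unfolding F_def H_def by (rule hyp2F1_wronskian[OF r r1, of p q]) blast
  have H_ge: "H y \<ge> 1" if "0 \<le> y" "y < 1" for y
    unfolding H_def using p q r1 that by (intro hyp2F1_ge_1) auto
  \<comment> \<open>The reciprocal quotient, since now \<open>H\<close> is the function known to be
    positive. It is studied only on the open interval because its denominator vanishes at 0.\<close>
  define \<phi> where "\<phi> x = F x / (x powr (1 - r) * H x)" for x
  have \<phi>_decr: "\<phi> b < \<phi> a" if "0 < a" "a < b" "b < 1" for a b
  proof (rule DERIV_neg_imp_decreasing[OF that(2)])
    fix y assume "a \<le> y" "y \<le> b"
    then have y: "0 < y" "y < 1" using that by auto
    let ?D = "(y powr (1 - r) * H y) * (y powr (1 - r) * H y)"
    have D: "?D > 0" using y H_ge[of y] by simp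
    have "(\<phi> has_real_derivative (F' y * (y powr (1 - r) * H y)
        - F y * ((1 - r) * y powr (- r) * H y + y powr (1 - r) * H' y)) / ?D) (at y)"
      unfolding \<phi>_def[abs_def] using y H_ge[of y]
      by (auto intro!: derivative_eq_intros F' H')
    also have "F' y * (y powr (1 - r) * H y) - F y * ((1 - r) * y powr (- r) * H y + y powr (1 - r) * H' y)
        = - (y powr (- r) * (F y * ((1 - r) * H y + y * H' y) - y * F' y * H y))"
    proof -
      have e: "y powr (1 - r) = y powr (- r) * y"
        using y by (simp add: powr_diff powr_minus divide_inverse)
      show ?thesis unfolding e by (simp add: algebra_simps)
    qed
    finally show "\<exists>z. (\<phi> has_real_derivative z) (at y) \<and> z < 0"
      using W[of y] D y by (intro exI conjI) (assumption, auto intro!: divide_neg_pos)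
  qed
  \<comment> \<open>Moving strictly beyond \<open>x\<close> turns \<open>\<phi> x \<le> 0\<close>
    into a strict inequality; from there on the function stays below a fixed negative multiple of
    the second solution.\<close>
  define x1 where "x1 = (x + 1) / 2"
  have x1: "0 < x1" "x < x1" "x1 < 1" using x by (auto simp: x1_def)
  have "\<phi> x \<le> 0" using Fx H_ge[of x] x
    by (auto simp: \<phi>_def intro!: divide_nonpos_pos)
  then have \<phi>1: "\<phi> x1 < 0" using \<phi>_decr[of x x1] x x1 by linarith
  have F_le: "F y \<le> \<phi> x1 * (y powr (1 - r) * H y)" if "x1 < y" "y < 1" for y
  proof -
    have "\<phi> y < \<phi> x1" using \<phi>_decr[of x1 y] x1 that by simp
    moreover have "y powr (1 - r) * H y > 0" using that x1 H_ge[of y] by simp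
    ultimately show ?thesis by (simp add: \<phi>_def divide_less_eq)
  qed
  show False
  proof (cases "gsign p * gsign q * gsign r = 0")
    case False
    with s have s: "gsign p * gsign q * gsign r > 0" by linarith
    from hyp2F1_at_left_1[OF r d False]
    have "\<forall>\<^sub>F y in at_left 1. 0 < gsign p * gsign q * gsign r * F y"
      by (simp add: F_def filterlim_at_top_dense)
    then obtain y where y: "x1 < y" "y < 1" "0 < gsign p * gsign q * gsign r * F y"
      using at_left_1_witness x1(3) by blast
    then have "F y > 0" using s by (simp add: zero_less_mult_iff)
    moreover have "\<phi> x1 * (y powr (1 - r) * H y) \<le> 0"
      using \<phi>1 y x1 H_ge[of y] by (intro mult_nonpos_nonneg) auto
    ultimately show False using F_le[of y] y by simp
  next
    case True
    have "gsign r \<noteq> 0" using r by (simp add: gsign_def sgn_0_0 rGamma_eq_zero_iff)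
    with True have int: "p \<in> \<int>\<^sub>\<le>\<^sub>0 \<or> q \<in> \<int>\<^sub>\<le>\<^sub>0"
      by (auto simp: gsign_def sgn_0_0 rGamma_eq_zero_iff)
    then obtain B where B: "\<And>y. 0 < y \<Longrightarrow> y < 1 \<Longrightarrow> \<bar>F y\<bar> \<le> B"
      using hyp2F1_polynomial_bounded[of p q r] hyp2F1_polynomial_bounded[of q p r]
      unfolding F_def hyp2F1_commute[of q p r] by blast
    \<comment> \<open>Equality would make \<open>r\<close> an integer below 1, which is excluded. If
      one of \<open>p\<close>, \<open>q\<close> is a nonpositive integer, it is thus strictly above
      \<open>r - 1\<close>, and the other is at least \<open>r\<close>; so \<open>H\<close> has
      positive upper parameters and diverges at 1.\<close>
    have ne: "a \<noteq> r - 1" if "a \<in> \<int>\<^sub>\<le>\<^sub>0" for a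
    proof
      assume "a = r - 1"
      then have "r \<in> \<int>" using that nonpos_Ints_Int by (metis Ints_1 Ints_add diff_add_cancel)
      with r r1 show False by (auto elim!: Ints_cases simp: nonpos_Ints_def)
    qed
    have "a \<le> 0" if "a \<in> \<int>\<^sub>\<le>\<^sub>0" for a :: real using that by (rule nonpos_Ints_nonpos)
    with int ne d p q have pos: "p - r + 1 > 0" "q - r + 1 > 0" by (smt (verit))+
    have r': "2 - r \<notin> \<int>\<^sub>\<le>\<^sub>0" using r1 by auto
    have "gsign (p - r + 1) * gsign (q - r + 1) * gsign (2 - r) = 1"
      using pos r1 by (simp add: gsign_pos)
    with hyp2F1_at_left_1[OF r', of "p - r + 1" "q - r + 1"] d r1
    have "filterlim H at_top (at_left 1)" by (simp add: H_def[symmetric])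
    \<comment> \<open>Chosen so that \<open>H y > M\<close> pushes \<open>- F y\<close> above the
      bound \<open>B\<close> of the polynomial; \<open>y powr (1 - r)\<close> is at least its value
      at \<open>x1\<close>.\<close>
    moreover define M where "M = B / (- \<phi> x1 * x1 powr (1 - r))"
    ultimately have "\<forall>\<^sub>F y in at_left 1. M < H y"
      by (simp add: filterlim_at_top_dense)
    then obtain y where y: "x1 < y" "y < 1" "M < H y"
      using at_left_1_witness x1(3) by blast
    have pos1: "- \<phi> x1 * x1 powr (1 - r) > 0" using \<phi>1 x1 by (simp add: mult_neg_pos)
    have "B < - \<phi> x1 * x1 powr (1 - r) * H y"
      using y(3) pos1 unfolding M_def by (subst (asm) divide_less_eq) (auto simp: mult_ac)
    also have "\<dots> \<le> - \<phi> x1 * y powr (1 - r) * H y"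
      using \<phi>1 y x1 r1 H_ge[of y]
      by (intro mult_right_mono mult_left_mono powr_mono2) auto
    also have "\<dots> \<le> - F y" using F_le[of y] y by (simp add: mult_ac)
    also have "\<dots> \<le> B" using B[of y] y x1 by simp
    finally show False by simp
  qed
qed

section \<open>Characterizations of positivity\<close>

text \<open>The sign condition is necessary because a negative sign product makes the function
  negative near 1.\<close>

lemma hyp2F1_pos_iff_r_less_1:
  fixes p q r :: real
  assumes r: "r \<notin> \<int>\<^sub>\<le>\<^sub>0" and r1: "r < 1" and d: "p + q \<ge> r"
  shows "(\<forall>x\<in>{0<..<1}. hyp2F1 p q r x > 0) \<longleftrightarrow>
    p \<ge> r - 1 \<and> q \<ge> r - 1 \<and> gsign p * gsign q * gsign r \<ge> 0"
proof
  assume pos: "\<forall>x\<in>{0<..<1}. hyp2F1 p q r x > 0"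
  have "p \<ge> r - 1" using hyp2F1_pos_imp_ge[OF r r1 d] pos by auto
  moreover have "q \<ge> r - 1"
    using hyp2F1_pos_imp_ge[OF r r1, of q p] d pos by (auto simp: hyp2F1_commute[of q p] add.commute)
  moreover have "gsign p * gsign q * gsign r \<ge> 0"
  proof (rule ccontr)
    assume s: "\<not> ?thesis"
    then have "gsign p * gsign q * gsign r \<noteq> 0" by auto
    from hyp2F1_at_left_1[OF r d this]
    have "\<forall>\<^sub>F y in at_left 1. 0 < gsign p * gsign q * gsign r * hyp2F1 p q r y"
      by (simp add: filterlim_at_top_dense)
    then obtain y where y: "0 < y" "y < 1" "0 < gsign p * gsign q * gsign r * hyp2F1 p q r y"
      using at_left_1_witness zero_less_one by blast
    then have "hyp2F1 p q r y < 0" using s zero_less_mult_iff[of "gsign p * gsign q * gsign r"] by auto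
    with pos y show False by force
  qed
  ultimately show "p \<ge> r - 1 \<and> q \<ge> r - 1 \<and> gsign p * gsign q * gsign r \<ge> 0" by simp
qed (use hyp2F1_pos_if[OF r r1 d] in auto)

text \<open>Opposite signs of \<open>p\<close> and \<open>q\<close> are excluded by the self-adjoint
  argument, and two nonpositive parameters by \<open>p + q \<ge> r > 0\<close>.\<close>

lemma hyp2F1_pos_iff_r_pos:
  fixes p q r :: real
  assumes r: "r > 0" and d: "p + q \<ge> r"
  shows "(\<forall>x\<in>{0<..<1}. hyp2F1 p q r x > 0) \<longleftrightarrow> p \<ge> 0 \<and> q \<ge> 0"
proof
  assume "\<forall>x\<in>{0<..<1}. hyp2F1 p q r x > 0"
  then have "p * q \<ge> 0"
    using hyp2F1_nonpos_if_opposite_signs[OF r _ d] by fastforce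
  then show "p \<ge> 0 \<and> q \<ge> 0" using r d by (auto simp: zero_le_mult_iff)
next
  assume pq: "p \<ge> 0 \<and> q \<ge> 0"
  show "\<forall>x\<in>{0<..<1}. hyp2F1 p q r x > 0"
    using hyp2F1_ge_1[of p q r] pq r by (force intro: less_le_trans[OF zero_less_one])
qed

lemma hyp2F1_pos_iff:
  fixes p q r :: real
  assumes r: "r \<notin> \<int>\<^sub>\<le>\<^sub>0" and d: "r - p - q \<le> 0"
  shows "(\<forall>x\<in>{0<..<1}. hyp2F1 p q r x > 0) \<longleftrightarrow>
      (r \<ge> 1 \<and> p \<ge> 0 \<and> q \<ge> 0)
    \<or> (r < 1 \<and> r - p \<le> 1 \<and> r - q \<le> 1 \<and> (p, q, r) \<in> signset)"
proof (cases "r \<ge> 1")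
  case True
  then show ?thesis using hyp2F1_pos_iff_r_pos[of r p q] d by auto
next
  case False
  then show ?thesis using hyp2F1_pos_iff_r_less_1[OF r, of p q] d by (auto simp: signset_def)
qed

lemma hyp2F1_pos_iff_euler:
  fixes p q r :: real
  assumes r: "r \<notin> \<int>\<^sub>\<le>\<^sub>0"
  shows "(\<forall>x\<in>{0<..<1}. hyp2F1 p q r x > 0) \<longleftrightarrow> (\<forall>x\<in>{0<..<1}. hyp2F1 (r - p) (r - q) r x > 0)"
proof (rule ball_cong[OF refl])
  fix x :: real assume "x \<in> {0<..<1}"
  then show "hyp2F1 p q r x > 0 \<longleftrightarrow> hyp2F1 (r - p) (r - q) r x > 0"
    using euler_transformation[OF r, of x p q, symmetric] by (simp add: zero_less_mult_iff)
qed

theorem theorem2p2: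
  fixes p q r :: real
  assumes "r \<notin> \<int>\<^sub>\<le>\<^sub>0"
  shows "(\<forall>x\<in>{0<..<1}. hyp2F1 p q r x > 0) \<longleftrightarrow>
     (r \<ge> 1 \<and> r - p - q \<le> 0 \<and> p \<ge> 0 \<and> q \<ge> 0)
   \<or> (r \<ge> 1 \<and> r - p - q \<ge> 0 \<and> r - p \<ge> 0 \<and> r - q \<ge> 0)
   \<or> (r < 1 \<and> r - p - q \<le> 0 \<and> r - p \<le> 1 \<and> r - q \<le> 1 \<and> (p, q, r) \<in> signset)
   \<or> (r < 1 \<and> r - p - q \<ge> 0 \<and> p \<le> 1 \<and> q \<le> 1 \<and> (r - p, r - q, r) \<in> signset)"
  (is "?P \<longleftrightarrow> ?rhs")
proof -
  have 1: "?P \<longleftrightarrow> (r \<ge> 1 \<and> p \<ge> 0 \<and> q \<ge> 0)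
      \<or> (r < 1 \<and> r - p \<le> 1 \<and> r - q \<le> 1 \<and> (p, q, r) \<in> signset)" if "r - p - q \<le> 0"
    by (rule hyp2F1_pos_iff[OF assms that])
  \<comment> \<open>Replacing \<open>p\<close>, \<open>q\<close> by \<open>r - p\<close>,
    \<open>r - q\<close> reverses the sign of \<open>r - p - q\<close>, and Euler's transformation
    preserves positivity.\<close>
  have 2: "?P \<longleftrightarrow> (r \<ge> 1 \<and> r - p \<ge> 0 \<and> r - q \<ge> 0)
      \<or> (r < 1 \<and> p \<le> 1 \<and> q \<le> 1 \<and> (r - p, r - q, r) \<in> signset)" if "r - p - q \<ge> 0"
    using hyp2F1_pos_iff[OF assms, of "r - p" "r - q"] that
    unfolding hyp2F1_pos_iff_euler[OF assms, of p q] by simp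
  consider "r - p - q < 0" | "r - p - q > 0" | "r - p - q = 0" by linarith
  then show ?thesis
  proof cases
    case 1
    then show ?thesis using \<open>r - p - q \<le> 0 \<Longrightarrow> _\<close> by simp
  next
    case 2
    then show ?thesis using \<open>r - p - q \<ge> 0 \<Longrightarrow> _\<close> by simp
  next
    \<comment> \<open>On the common boundary both equivalences hold, so the alternatives from either
      side agree.\<close>
    case 3
    then show ?thesis using 1 2 by auto
  qed
qed

end
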